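(* Let $p,q,r>1$, $A>0$, $B>0$, $R\ge 1$, and let $(f,g)\in C_0^2(\mathbf{R})\times C_0^1(\mathbf{R})$ satisfy $\mathrm{supp}\,f,\ \mathrm{supp}\,g\subset\{x\in\mathbf{R}: |x|\le R\}$. Assume that $$f(x)\ge0\ (f\not\equiv0),\qquad g(x)\equiv0,\qquad f(x)\ge f_0\ \text{ and }\ -f'(x)\ge f_0\ \text{ for } x\in(-R/2,0),$$ with some positive constant $f_0$. Then there exist a positive constant $\varepsilon_4=\varepsilon_4(f,p,q,r,A,B,R)>0$ and a positive constant $C$ independent of $\varepsilon$ such that, for every $\varepsilon$ with $0<\varepsilon\le\varepsilon_4$, no classical solution of the initial value problem $$u_{tt}-u_{xx}=A|u_t|^p|u|^q+B|u|^r,\qquad u(x,0)=\varepsilon f(x),\quad u_t(x,0)=\varepsilon g(x)\quad (x\in\mathbf{R})$$ in the time interval $[0,T]$ can exist as far as $T$ satisfies $$T\ge\begin{cases} C\,\varepsilon^{-(p+q-1)} & \text{if } p+q\le\dfrac{r+1}{2},\\[2mm] C\,\varepsilon^{-(p+q)(r-1)/(r+1)} & \text{if } \dfrac{r+1}{2}\le p+q\le r,\\[2mm] C\,\varepsilon^{-r(r-1)/(r+1)} & \text{if } p+q\ge r.\end{cases}$$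
   Context: $C_0^k(\mathbf{R})$ denotes the real-valued $C^k$ functions on $\mathbf{R}$ with compact support. A classical solution in the time interval $[0,T]$ is a real-valued function $u\in C^2(\mathbf{R}\times[0,T])$ satisfying the equation and the initial conditions pointwise. The space dimension is one. *)

theory Defs
  imports "HOL-Analysis.Analysis"
begin

primrec Ck_real :: "nat \<Rightarrow> (real \<Rightarrow> real) \<Rightarrow> bool" where
  "Ck_real 0 f \<longleftrightarrow> continuous_on UNIV f"
| "Ck_real (Suc k) f \<longleftrightarrow>
     continuous_on UNIV f \<and> (\<forall>x. f differentiable (at x)) \<and> Ck_real k (deriv f)"

definition supp :: "(real \<Rightarrow> real) \<Rightarrow> real set" where
  "supp f = closure {x. f x \<noteq> 0}"

definition C0k :: "nat \<Rightarrow> (real \<Rightarrow> real) set" where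
  "C0k k = {f. Ck_real k f \<and> compact (supp f)}"

definition pd_x :: "(real \<Rightarrow> real \<Rightarrow> real) \<Rightarrow> real \<Rightarrow> real \<Rightarrow> real" where
  "pd_x u x t = deriv (\<lambda>y. u y t) x"

text \<open>The time derivative is taken relative to the interval \<open>[0,T]\<close>: it is the ordinary
  derivative for \<open>0 < t < T\<close> and the one-sided one at \<open>t = 0\<close> and \<open>t = T\<close>. It is
  meaningful only for \<open>T > 0\<close>.\<close>

definition pd_t :: "real \<Rightarrow> (real \<Rightarrow> real \<Rightarrow> real) \<Rightarrow> real \<Rightarrow> real \<Rightarrow> real" where
  "pd_t T u x t = vector_derivative (\<lambda>s. u x s) (at t within {0..T})"

text \<open>\<open>u \<in> C\<^sup>k(\<real> \<times> [0,T])\<close>: all partial derivatives of order at most \<open>k\<close>, mixed ones in either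
  order included, exist and are continuous on the closed strip. The values of \<open>u x t\<close> for \<open>t\<close>
  outside \<open>[0,T]\<close> play no role.\<close>

primrec Ck_strip :: "nat \<Rightarrow> real \<Rightarrow> (real \<Rightarrow> real \<Rightarrow> real) \<Rightarrow> bool" where
  "Ck_strip 0 T u \<longleftrightarrow> continuous_on (UNIV \<times> {0..T}) (\<lambda>(x, t). u x t)"
| "Ck_strip (Suc k) T u \<longleftrightarrow>
     continuous_on (UNIV \<times> {0..T}) (\<lambda>(x, t). u x t) \<and>
     (\<forall>x. \<forall>t\<in>{0..T}. (\<lambda>y. u y t) differentiable (at x) \<and>
                      (\<lambda>s. u x s) differentiable (at t within {0..T})) \<and>
     Ck_strip k T (pd_x u) \<and> Ck_strip k T (pd_t T u)"

definition classical_solution ::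
  "real \<Rightarrow> real \<Rightarrow> real \<Rightarrow> real \<Rightarrow> real \<Rightarrow> (real \<Rightarrow> real) \<Rightarrow> (real \<Rightarrow> real) \<Rightarrow> real \<Rightarrow> real
    \<Rightarrow> (real \<Rightarrow> real \<Rightarrow> real) \<Rightarrow> bool" where
  "classical_solution p q r A B f g \<epsilon> T u \<longleftrightarrow>
     Ck_strip 2 T u \<and>
     (\<forall>x. \<forall>t\<in>{0..T}.
        pd_t T (pd_t T u) x t - pd_x (pd_x u) x t =
          A * \<bar>pd_t T u x t\<bar> powr p * \<bar>u x t\<bar> powr q + B * \<bar>u x t\<bar> powr r) \<and>
     (\<forall>x. u x 0 = \<epsilon> * f x \<and> pd_t T u x 0 = \<epsilon> * g x)"

end

theory Submission
  imports Defs
begin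

text \<open>
  Lower bounds propagate because the nonlinearity \<open>F\<close> is nonnegative: in the null coordinates
  \<open>a = t - x\<close> and \<open>b = t + x\<close> the equation reads \<open>4 u\<^sub>a\<^sub>b = F\<close>, so \<open>u\<^sub>a\<close> is nondecreasing in \<open>b\<close> and
  \<open>u\<^sub>b\<close> in \<open>a\<close>, and both dominate their values for the free wave. In particular \<open>u \<ge> 0\<close>, and in the
  strip \<open>0 < a < R / 2\<close>, \<open>b > R\<close>, both \<open>u\<close> and \<open>u\<^sub>t\<close> are at least \<open>\<epsilon> f0 / 2\<close>, because the strip carries
  the part of the datum where \<open>f\<close> and minus its derivative are at least \<open>f0\<close>. Two mechanisms then
  force blow-up.

  Inside the strip the mixed term alone acts. There \<open>u\<close> is at least half the integral of
  \<open>V = u\<^sub>t - u\<^sub>x\<close> over an interval of \<open>a\<close> of bounded length, \<open>u\<^sub>t\<close> is at least \<open>V / 2\<close>, and so the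
  derivative of \<open>V\<close> in \<open>b\<close> is bounded below by a multiple of \<open>V\<^sup>p u\<^sup>q\<close>; this
  behaves like the ordinary differential equation with power \<open>p + q\<close> and initial value of order \<open>\<epsilon>\<close>,
  whose lifespan is of order \<open>\<epsilon>\<close> to the power \<open>-(p + q - 1)\<close> (lemma \<open>damped_growth_bound\<close>).

  Behind the strip the source acts. In the strip \<open>F \<ge> N\<close> with \<open>N\<close> of order \<open>\<epsilon>\<close> to the power \<open>P\<close>, where
  \<open>P = p + q\<close> from the mixed term or \<open>P = r\<close> from the source. This accumulates to \<open>u\<close> of order \<open>N T\<close> on
  the square \<open>T / 2 \<le> a, b \<le> T\<close> (lemma \<open>linear_growth\<close>), where \<open>u\<^sub>a\<^sub>b\<close> is at least \<open>B u\<^sup>r / 4\<close>. Scaling the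
  square to unit size shows that \<open>T\<^sup>2 (N T)\<^sup>r\<^sup>-\<^sup>1\<close> must stay bounded (lemma \<open>source_growth_bound\<close>), which
  is the lifespan of order \<open>\<epsilon>\<close> to the power \<open>-P (r - 1) / (r + 1)\<close>.

  Both blow-up statements are proved by iterating a pointwise lower bound over domains that shrink
  geometrically to a nonempty limit: the bounds grow without limit by lemma \<open>geometric_step\<close>, but all
  of them apply at one fixed point of the limit domain, where the solution is finite. Choosing \<open>C\<close> large
  covers every \<open>\<epsilon> \<le> 1\<close>.
\<close>

section \<open>Calculus of functions on the closed strip\<close>

text \<open>
  The form in which the equation is integrated along characteristics. The derivative is asked for in
  the open interval only, because on the boundary of the strip the time derivatives are one-sided.
\<close>

lemma increment_ge:
  fixes h :: "real \<Rightarrow> real"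
  assumes "a \<le> b" "continuous_on {a..b} h"
    and deriv: "\<And>x. a < x \<Longrightarrow> x < b \<Longrightarrow> (h has_real_derivative h' x) (at x)"
    and ge: "\<And>x. a < x \<Longrightarrow> x < b \<Longrightarrow> c \<le> h' x"
  shows "c * (b - a) \<le> h b - h a"
proof (cases "a = b")
  case False
  with assms(1) have "a < b" by simp
  obtain z where z: "a < z" "z < b" and eq: "h b - h a = h' z * (b - a)"
    using mvt[OF \<open>a < b\<close> assms(2) deriv[unfolded has_field_derivative_def]] by blast
  show ?thesis
    unfolding eq using ge[OF z] \<open>a < b\<close> by (intro mult_right_mono) auto
qed simp

text \<open>
  The second difference of \<open>w\<close> over a small square with corner \<open>(x, t)\<close> equals the area times a value
  of \<open>wxt\<close> inside the square, and also the area times a value of \<open>wtx\<close>, by the mean value theorem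
  used twice in either order. Shrinking the square gives the claim.
\<close>

lemma mixed_partials_commute:
  fixes w wx wt wxt wtx :: "real \<Rightarrow> real \<Rightarrow> real"
  assumes t: "t \<in> {0<..<T}"
    and x': "\<And>x t. t \<in> {0<..<T} \<Longrightarrow> ((\<lambda>y. w y t) has_real_derivative wx x t) (at x)"
    and t': "\<And>x t. t \<in> {0<..<T} \<Longrightarrow> ((\<lambda>s. w x s) has_real_derivative wt x t) (at t)"
    and xt': "\<And>x t. t \<in> {0<..<T} \<Longrightarrow> ((\<lambda>s. wx x s) has_real_derivative wxt x t) (at t)"
    and tx': "\<And>x t. t \<in> {0<..<T} \<Longrightarrow> ((\<lambda>y. wt y t) has_real_derivative wtx x t) (at x)"
    and cont: "isCont (\<lambda>(x, t). wxt x t) (x, t)" "isCont (\<lambda>(x, t). wtx x t) (x, t)"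
  shows "wxt x t = wtx x t"
proof -
  have close: "\<bar>wxt x t - wtx x t\<bar> \<le> 2 * e" if "e > 0" for e
  proof -
    obtain d1 where d1: "d1 > 0"
      "\<And>y s. dist (y, s) (x, t) < d1 \<Longrightarrow> \<bar>wxt y s - wxt x t\<bar> < e"
      using cont(1) \<open>e > 0\<close> unfolding continuous_at_eps_delta dist_real_def by fastforce
    obtain d2 where d2: "d2 > 0"
      "\<And>y s. dist (y, s) (x, t) < d2 \<Longrightarrow> \<bar>wtx y s - wtx x t\<bar> < e"
      using cont(2) \<open>e > 0\<close> unfolding continuous_at_eps_delta dist_real_def by fastforce
    define h where "h = min (min d1 d2) (T - t) / 2"
    have h: "h > 0" "2 * h \<le> d1" "2 * h \<le> d2" "t + h < T"
      using d1(1) d2(1) t by (auto simp: h_def min_def field_simps)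
    have near: "dist (y, s) (x, t) < 2 * h" if "x < y" "y < x + h" "t < s" "s < t + h" for y s
      using that sqrt_sum_squares_le_sum_abs[of "y - x" "s - t"]
      by (auto simp: dist_prod_def dist_real_def)
    have inI: "s \<in> {0<..<T}" if "t \<le> s" "s \<le> t + h" for s
      using that t h by auto
    have "\<exists>y. x < y \<and> y < x + h \<and>
        (w (x + h) (t + h) - w (x + h) t) - (w x (t + h) - w x t)
          = (x + h - x) * (wx y (t + h) - wx y t)"
      using h(1) inI[of t] inI[of "t + h"]
      by (intro MVT2) (auto intro!: derivative_intros x')
    then obtain y1 where y1: "x < y1" "y1 < x + h"
      "(w (x + h) (t + h) - w (x + h) t) - (w x (t + h) - w x t) = h * (wx y1 (t + h) - wx y1 t)"
      by auto
    have "\<exists>s. t < s \<and> s < t + h \<and> wx y1 (t + h) - wx y1 t = (t + h - t) * wxt y1 s"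
      using h(1) inI by (intro MVT2) (auto intro!: xt')
    then obtain s1 where s1: "t < s1" "s1 < t + h" "wx y1 (t + h) - wx y1 t = h * wxt y1 s1"
      by auto
    have "\<exists>s. t < s \<and> s < t + h \<and>
        (w (x + h) (t + h) - w x (t + h)) - (w (x + h) t - w x t)
          = (t + h - t) * (wt (x + h) s - wt x s)"
      using h(1) inI
      by (intro MVT2) (auto intro!: derivative_intros t')
    then obtain s2 where s2: "t < s2" "s2 < t + h"
      "(w (x + h) (t + h) - w x (t + h)) - (w (x + h) t - w x t) = h * (wt (x + h) s2 - wt x s2)"
      by auto
    have "\<exists>y. x < y \<and> y < x + h \<and> wt (x + h) s2 - wt x s2 = (x + h - x) * wtx y s2"
      using h(1) inI[of s2] s2 by (intro MVT2) (auto intro!: tx')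
    then obtain y2 where y2: "x < y2" "y2 < x + h" "wt (x + h) s2 - wt x s2 = h * wtx y2 s2"
      by auto
    have "h * (h * wxt y1 s1) = h * (h * wtx y2 s2)"
      using y1(3) s1(3) s2(3) y2(3) by (simp only: mult.left_commute)
    then have "wxt y1 s1 = wtx y2 s2"
      using h(1) by simp
    moreover have "\<bar>wxt y1 s1 - wxt x t\<bar> < e"
      using near[OF y1(1,2) s1(1,2)] h by (intro d1(2)) auto
    moreover have "\<bar>wtx y2 s2 - wtx x t\<bar> < e"
      using near[OF y2(1,2) s2(1,2)] h by (intro d2(2)) auto
    ultimately show ?thesis by linarith
  qed
  show ?thesis
  proof (rule ccontr)
    assume "wxt x t \<noteq> wtx x t"
    then have "\<bar>wxt x t - wtx x t\<bar> > 0" by simp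
    then show False
      using close[of "\<bar>wxt x t - wtx x t\<bar> / 4"] by simp
  qed
qed

lemma isCont_strip:
  assumes "continuous_on (UNIV \<times> {0..T}) (\<lambda>(x, t). w x t)" "t \<in> {0<..<T}"
  shows "isCont (\<lambda>(x, t). w x t) (x, t :: real)"
proof -
  have "continuous_on (UNIV \<times> {0<..<T}) (\<lambda>(x, t). w x t)"
    by (rule continuous_on_subset[OF assms(1)]) auto
  moreover have "open ((UNIV :: 'a set) \<times> {0<..<T})"
    by (intro open_Times) auto
  ultimately show ?thesis
    using assms(2) by (simp add: continuous_on_eq_continuous_at)
qed

lemma Ck_strip_partials:
  assumes "Ck_strip (Suc k) T w" "t \<in> {0<..<T}"
  shows "((\<lambda>y. w y t) has_real_derivative pd_x w x t) (at x)"
    and "((\<lambda>s. w x s) has_real_derivative pd_t T w x t) (at t)"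
proof -
  have dx: "(\<lambda>y. w y t) differentiable (at x)"
    and dt: "(\<lambda>s. w x s) differentiable (at t within {0..T})"
    using assms by auto
  show "((\<lambda>y. w y t) has_real_derivative pd_x w x t) (at x)"
    using dx unfolding pd_x_def
    by (simp add: DERIV_deriv_iff_real_differentiable)
  have at: "at t within {0..T} = at t"
    using assms(2) by (intro at_within_interior) auto
  show "((\<lambda>s. w x s) has_real_derivative pd_t T w x t) (at t)"
    using dt unfolding pd_t_def at has_real_derivative_iff_has_vector_derivative
    by (simp add: vector_derivative_works)
qed

text \<open>
  The hypothesis only gives continuous partial derivatives, so total differentiability has to be
  recovered before the chain rule along a curve applies. Restricting to interior times removes the
  one-sided time derivatives.
\<close>

lemma Ck_strip_chain:
  assumes w: "Ck_strip (Suc k) T w"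
    and X: "(X has_real_derivative X') (at s)" and Y: "(Y has_real_derivative Y') (at s)"
    and s: "0 < Y s" "Y s < T"
  shows "((\<lambda>s. w (X s) (Y s)) has_real_derivative
           X' * pd_x w (X s) (Y s) + Y' * pd_t T w (X s) (Y s)) (at s)"
proof -
  let ?I = "{0<..<T}"
  have cont: "continuous_on (UNIV \<times> {0..T}) (\<lambda>(x, t). pd_t T w x t)"
    using w by (cases k) auto
  have "isCont (\<lambda>(x, t). blinfun_scaleR_left (pd_t T w x t)) (X s, Y s)"
    using isCont_strip[OF cont, of "Y s" "X s"] s unfolding split_beta'
    by (auto intro: continuous_intros)
  then have c: "continuous (at (X s, Y s) within UNIV \<times> ?I)
      (\<lambda>(x, t). blinfun_scaleR_left (pd_t T w x t))"
    by (rule continuous_at_imp_continuous_at_within)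
  have "((\<lambda>(x, t). w x t) has_derivative
      (\<lambda>(h, k). pd_x w (X s) (Y s) * h + blinfun_apply (blinfun_scaleR_left (pd_t T w (X s) (Y s))) k))
      (at (X s, Y s) within UNIV \<times> ?I)"
  proof (rule has_derivative_partialsI[OF _ _ c])
    show "((\<lambda>x. w x (Y s)) has_derivative (*) (pd_x w (X s) (Y s))) (at (X s) within UNIV)"
      using Ck_strip_partials(1)[OF w, of "Y s" "X s"] s
      unfolding has_field_derivative_def by simp
    show "((\<lambda>t. w x t) has_derivative blinfun_apply (blinfun_scaleR_left (pd_t T w x t)))
        (at t within ?I)" if "t \<in> ?I" for x t
    proof (rule has_derivative_at_withinI)
      have "blinfun_apply (blinfun_scaleR_left (pd_t T w x t)) = (*) (pd_t T w x t)"
        by (rule ext) (simp add: mult.commute)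
      then show "((\<lambda>t. w x t) has_derivative
          blinfun_apply (blinfun_scaleR_left (pd_t T w x t))) (at t)"
        using Ck_strip_partials(2)[OF w that, of x] unfolding has_field_derivative_def by simp
    qed
  qed (use s in auto)
  moreover have "at (X s, Y s) within UNIV \<times> ?I = at (X s, Y s)"
    using s by (intro at_within_open open_Times) auto
  ultimately have D: "((\<lambda>(x, t). w x t) has_derivative
      (\<lambda>(h, k). pd_x w (X s) (Y s) * h + pd_t T w (X s) (Y s) * k)) (at (X s, Y s))"
    by (simp add: mult.commute)
  have "((\<lambda>s. (X s, Y s)) has_derivative (\<lambda>h. (X' * h, Y' * h))) (at s)"
    using X Y unfolding has_field_derivative_def by (rule has_derivative_Pair)
  from has_derivative_compose[OF this D]
  have "((\<lambda>s. w (X s) (Y s)) has_derivative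
      (\<lambda>h. pd_x w (X s) (Y s) * (X' * h) + pd_t T w (X s) (Y s) * (Y' * h))) (at s)"
    by simp
  then show ?thesis
    unfolding has_field_derivative_def
    by (rule has_derivative_eq_rhs) (simp add: fun_eq_iff algebra_simps)
qed

lemma Ck_strip_mixed:
  assumes u: "Ck_strip 2 T u" and t: "t \<in> {0<..<T}"
  shows "pd_t T (pd_x u) x t = pd_x (pd_t T u) x t"
proof -
  have u2: "Ck_strip (Suc (Suc 0)) T u" using u by (simp add: numeral_2_eq_2)
  then have ux: "Ck_strip (Suc 0) T (pd_x u)" and ut: "Ck_strip (Suc 0) T (pd_t T u)"
    by simp_all
  then have "continuous_on (UNIV \<times> {0..T}) (\<lambda>(x, t). pd_t T (pd_x u) x t)"
    and "continuous_on (UNIV \<times> {0..T}) (\<lambda>(x, t). pd_x (pd_t T u) x t)"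
    by simp_all
  note cont = this[THEN isCont_strip, OF t]
  show ?thesis
    by (rule mixed_partials_commute[OF t _ _ _ _ cont])
      (rule Ck_strip_partials[OF u2] Ck_strip_partials[OF ux] Ck_strip_partials[OF ut], assumption)+
qed

section \<open>Geometric growth under a shrinking power iteration\<close>

text \<open>
  The arithmetic of both blow-up arguments. A lower bound \<open>K\<^sub>k\<close> is fed into a nonlinearity of power
  \<open>\<rho>\<close> acting on a domain that shrinks like \<open>2\<^sup>-\<^sup>k\<close>, which costs a factor \<open>2\<^sup>-\<^sup>\<kappa>\<^sup>k\<close>. The growth rate
  \<open>s = \<kappa> / (\<rho> - 1)\<close> of \<open>K\<^sub>k\<close> is the one for which gain and cost balance, so a largeness condition
  at \<open>k = 0\<close> is inherited by all \<open>k\<close>.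
\<close>

lemma geometric_step:
  fixes K \<Lambda> \<rho> \<kappa> s :: real
  assumes "K > 0" "\<rho> > 1" and s: "s * (\<rho> - 1) = \<kappa>"
    and large: "2 powr s - 1 \<le> \<Lambda> * K powr (\<rho> - 1)"
  shows "K * 2 powr (s * real (Suc k)) \<le> K * 2 powr (s * real k)
    + \<Lambda> * ((1/2) ^ k) powr \<kappa> * (K * 2 powr (s * real k)) powr \<rho>"
proof -
  define Kk where "Kk = K * 2 powr (s * real k)"
  have "Kk > 0" using assms(1) by (simp add: Kk_def)
  have half: "((1/2 :: real) ^ k) powr \<kappa> = 2 powr (- (\<kappa> * real k))"
    by (simp add: powr_realpow[symmetric] powr_powr powr_divide powr_minus_divide mult.commute)
  have "Kk powr \<rho> = Kk * Kk powr (\<rho> - 1)"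
    using \<open>Kk > 0\<close> powr_add[of Kk 1 "\<rho> - 1"] by simp
  moreover have "Kk powr (\<rho> - 1) = K powr (\<rho> - 1) * 2 powr (\<kappa> * real k)"
    using assms(1) by (simp add: Kk_def powr_mult powr_powr s[symmetric] mult_ac)
  ultimately have "((1/2) ^ k) powr \<kappa> * Kk powr \<rho>
      = Kk * K powr (\<rho> - 1) * (2 powr (- (\<kappa> * real k)) * 2 powr (\<kappa> * real k))"
    unfolding half by simp
  also have "\<dots> = Kk * K powr (\<rho> - 1)"
    by (simp add: powr_add[symmetric])
  finally have "Kk + \<Lambda> * ((1/2) ^ k) powr \<kappa> * Kk powr \<rho> = Kk * (1 + \<Lambda> * K powr (\<rho> - 1))"
    by (simp add: algebra_simps)
  moreover have "Kk * 2 powr s \<le> Kk * (1 + \<Lambda> * K powr (\<rho> - 1))"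
    using large \<open>Kk > 0\<close> by simp
  moreover have "K * 2 powr (s * real (Suc k)) = Kk * 2 powr s"
    by (simp add: Kk_def powr_add[symmetric] algebra_simps)
  ultimately show ?thesis unfolding Kk_def by linarith
qed

lemma geometric_unbounded:
  fixes K s M :: real
  assumes "K > 0" "s > 0"
  shows "\<exists>k. M < K * 2 powr (s * real k)"
proof -
  have "2 powr s > 1" using assms(2) by simp
  then obtain k where "M / K < (2 powr s) ^ k"
    using real_arch_pow by blast
  then show ?thesis
    using assms(1) by (auto simp: powr_realpow[symmetric] powr_powr field_simps)
qed

section \<open>The equation in null coordinates\<close>

locale decreasing_pulse =
  fixes p q r A B R f0 \<epsilon> T :: real and f g :: "real \<Rightarrow> real" and u :: "real \<Rightarrow> real \<Rightarrow> real"
  assumes pqr: "p > 1" "q > 1" "r > 1" and AB: "A > 0" "B > 0" and R: "R > 0"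
    and eps: "\<epsilon> > 0" and T: "T > 0"
    and f_smooth: "Ck_real 1 f" and f_supp: "supp f \<subseteq> {x. \<bar>x\<bar> \<le> R}"
    and f_nonneg: "f x \<ge> 0" and g_zero: "g x = 0" and f0: "f0 > 0"
    and pulse: "- R / 2 < x \<Longrightarrow> x < 0 \<Longrightarrow> f x \<ge> f0 \<and> - deriv f x \<ge> f0"
    and sol: "classical_solution p q r A B f g \<epsilon> T u"
begin

text \<open>
  The null coordinates are \<open>a = t - x\<close> and \<open>b = t + x\<close>, and times in \<open>[0, T]\<close> mean \<open>0 \<le> a + b \<le> 2 T\<close>. With
  \<open>U\<close> for the solution, \<open>V = u\<^sub>t - u\<^sub>x\<close> and \<open>W = u\<^sub>t + u\<^sub>x\<close> are twice its derivatives in \<open>a\<close> and \<open>b\<close>,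
  and the wave equation says that the derivatives of \<open>V\<close> in \<open>b\<close> and of \<open>W\<close> in \<open>a\<close> are half the
  nonlinearity \<open>F\<close>.
\<close>

definition U where "U a b = u ((b - a) / 2) ((a + b) / 2)"
definition Ut where "Ut a b = pd_t T u ((b - a) / 2) ((a + b) / 2)"
definition Ux where "Ux a b = pd_x u ((b - a) / 2) ((a + b) / 2)"
definition V where "V a b = Ut a b - Ux a b"
definition W where "W a b = Ut a b + Ux a b"
definition F where "F a b = A * \<bar>Ut a b\<bar> powr p * \<bar>U a b\<bar> powr q + B * \<bar>U a b\<bar> powr r"

lemma F_nonneg: "F a b \<ge> 0"
  using AB by (simp add: F_def)

lemma f_deriv: "(f has_real_derivative deriv f x) (at x)"
  using f_smooth by (simp add: DERIV_deriv_iff_real_differentiable)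

lemma deriv_f_outside:
  assumes "\<bar>x\<bar> > R"
  shows "deriv f x = 0"
proof -
  have zero: "f y = 0" if "\<bar>y\<bar> > R" for y
    using that f_supp closure_subset[of "{x. f x \<noteq> 0}"] unfolding supp_def by force
  have "open {y. \<bar>y\<bar> > R}"
    by (intro open_Collect_less continuous_intros)
  then have "((\<lambda>x. 0) has_real_derivative deriv f x) (at x)"
    by (rule has_field_derivative_transform_within_open[OF f_deriv]) (use assms zero in auto)
  then show ?thesis
    using DERIV_unique DERIV_const by blast
qed

lemma smooth: "Ck_strip (Suc 0) T u" "Ck_strip (Suc 0) T (pd_x u)" "Ck_strip (Suc 0) T (pd_t T u)"
proof -
  have "Ck_strip (Suc (Suc 0)) T u"
    using sol by (simp add: classical_solution_def numeral_2_eq_2)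
  then show "Ck_strip (Suc 0) T u" "Ck_strip (Suc 0) T (pd_x u)" "Ck_strip (Suc 0) T (pd_t T u)"
    by simp_all
qed

lemma null_derivatives_strip:
  assumes "Ck_strip (Suc 0) T w" "0 < a + b" "a + b < 2 * T"
  shows "((\<lambda>a. w ((b - a) / 2) ((a + b) / 2)) has_real_derivative
      (pd_t T w ((b - a) / 2) ((a + b) / 2) - pd_x w ((b - a) / 2) ((a + b) / 2)) / 2) (at a)"
    and "((\<lambda>b. w ((b - a) / 2) ((a + b) / 2)) has_real_derivative
      (pd_t T w ((b - a) / 2) ((a + b) / 2) + pd_x w ((b - a) / 2) ((a + b) / 2)) / 2) (at b)"
proof -
  have t: "0 < (a + b) / 2" "(a + b) / 2 < T" using assms(2,3) by auto
  have "((\<lambda>a. (b - a) / 2) has_real_derivative - 1 / 2) (at a)"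
    and "((\<lambda>a. (a + b) / 2) has_real_derivative 1 / 2) (at a)"
    by (auto intro!: derivative_eq_intros)
  from DERIV_cong[OF Ck_strip_chain[OF assms(1) this t]]
  show "((\<lambda>a. w ((b - a) / 2) ((a + b) / 2)) has_real_derivative
      (pd_t T w ((b - a) / 2) ((a + b) / 2) - pd_x w ((b - a) / 2) ((a + b) / 2)) / 2) (at a)"
    by (simp add: diff_divide_distrib)
  have "((\<lambda>b. (b - a) / 2) has_real_derivative 1 / 2) (at b)"
    and "((\<lambda>b. (a + b) / 2) has_real_derivative 1 / 2) (at b)"
    by (auto intro!: derivative_eq_intros)
  from DERIV_cong[OF Ck_strip_chain[OF assms(1) this t]]
  show "((\<lambda>b. w ((b - a) / 2) ((a + b) / 2)) has_real_derivative
      (pd_t T w ((b - a) / 2) ((a + b) / 2) + pd_x w ((b - a) / 2) ((a + b) / 2)) / 2) (at b)"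
    by (simp add: add_divide_distrib add.commute)
qed

lemma null_derivatives:
  assumes ab: "0 < a + b" "a + b < 2 * T"
  shows dU_da: "((\<lambda>a. U a b) has_real_derivative V a b / 2) (at a)"
    and dU_db: "((\<lambda>b. U a b) has_real_derivative W a b / 2) (at b)"
    and dV_db: "((\<lambda>b. V a b) has_real_derivative F a b / 2) (at b)"
    and dW_da: "((\<lambda>a. W a b) has_real_derivative F a b / 2) (at a)"
proof -
  show "((\<lambda>a. U a b) has_real_derivative V a b / 2) (at a)"
    and "((\<lambda>b. U a b) has_real_derivative W a b / 2) (at b)"
    using null_derivatives_strip[OF smooth(1) ab] unfolding U_def V_def W_def Ut_def Ux_def by auto
  have t: "(a + b) / 2 \<in> {0<..<T}" using ab by auto
  let ?x = "(b - a) / 2" and ?t = "(a + b) / 2"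
  have mixed: "pd_t T (pd_x u) ?x ?t = pd_x (pd_t T u) ?x ?t"
    using sol t by (intro Ck_strip_mixed) (auto simp: classical_solution_def)
  have eq: "pd_t T (pd_t T u) ?x ?t - pd_x (pd_x u) ?x ?t = F a b"
    using sol t unfolding classical_solution_def F_def U_def Ut_def by auto
  show "((\<lambda>b. V a b) has_real_derivative F a b / 2) (at b)"
    unfolding V_def Ut_def Ux_def
    by (rule DERIV_cong[OF DERIV_diff[OF null_derivatives_strip(2)[OF smooth(3) ab]
          null_derivatives_strip(2)[OF smooth(2) ab]]])
      (use mixed eq in \<open>simp add: field_simps\<close>)
  show "((\<lambda>a. W a b) has_real_derivative F a b / 2) (at a)"
    unfolding W_def Ut_def Ux_def
    by (rule DERIV_cong[OF DERIV_add[OF null_derivatives_strip(1)[OF smooth(3) ab]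
          null_derivatives_strip(1)[OF smooth(2) ab]]])
      (use mixed eq in \<open>simp add: field_simps\<close>)
qed

lemma null_continuous_strip:
  assumes "Ck_strip (Suc 0) T w"
  shows "0 \<le> a1 + b \<Longrightarrow> a2 + b \<le> 2 * T \<Longrightarrow>
      continuous_on {a1..a2} (\<lambda>a. w ((b - a) / 2) ((a + b) / 2))"
    and "0 \<le> a + b1 \<Longrightarrow> a + b2 \<le> 2 * T \<Longrightarrow>
      continuous_on {b1..b2} (\<lambda>b. w ((b - a) / 2) ((a + b) / 2))"
proof -
  have c: "continuous_on (UNIV \<times> {0..T}) (\<lambda>(x, t). w x t)" using assms by simp
  show "continuous_on {a1..a2} (\<lambda>a. w ((b - a) / 2) ((a + b) / 2))"
    if "0 \<le> a1 + b" "a2 + b \<le> 2 * T"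
    using that
    by (intro continuous_on_compose2[OF c, of _ "\<lambda>a. ((b - a) / 2, (a + b) / 2)", simplified]
         continuous_intros) auto
  show "continuous_on {b1..b2} (\<lambda>b. w ((b - a) / 2) ((a + b) / 2))"
    if "0 \<le> a + b1" "a + b2 \<le> 2 * T"
    using that
    by (intro continuous_on_compose2[OF c, of _ "\<lambda>b. ((b - a) / 2, (a + b) / 2)", simplified]
         continuous_intros) auto
qed

lemma null_continuous:
  shows "0 \<le> a1 + b \<Longrightarrow> a2 + b \<le> 2 * T \<Longrightarrow> continuous_on {a1..a2} (\<lambda>a. U a b)"
    and "0 \<le> a + b1 \<Longrightarrow> a + b2 \<le> 2 * T \<Longrightarrow> continuous_on {b1..b2} (\<lambda>b. U a b)"
    and "0 \<le> a + b1 \<Longrightarrow> a + b2 \<le> 2 * T \<Longrightarrow> continuous_on {b1..b2} (\<lambda>b. V a b)"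
    and "0 \<le> a1 + b \<Longrightarrow> a2 + b \<le> 2 * T \<Longrightarrow> continuous_on {a1..a2} (\<lambda>a. W a b)"
  unfolding U_def V_def W_def Ut_def Ux_def
  by (intro continuous_on_diff continuous_on_add null_continuous_strip smooth; assumption)+

lemma V_increment:
  assumes "b \<le> b'" "0 \<le> a + b" "a + b' \<le> 2 * T"
    and "\<And>s. b < s \<Longrightarrow> s < b' \<Longrightarrow> c \<le> F a s"
  shows "V a b + c / 2 * (b' - b) \<le> V a b'"
proof -
  have "c / 2 * (b' - b) \<le> V a b' - V a b"
    using assms
    by (intro increment_ge[where h' = "\<lambda>y. F a y / 2"] null_continuous dV_db) auto
  then show ?thesis by simp
qed

lemma W_mono:
  assumes "a \<le> a'" "0 \<le> a + b" "a' + b \<le> 2 * T"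
  shows "W a b \<le> W a' b"
proof -
  have "0 * (a' - a) \<le> W a' b - W a b"
    using assms F_nonneg
    by (intro increment_ge[where h' = "\<lambda>y. F y b / 2"] null_continuous dW_da) auto
  then show ?thesis by simp
qed

lemma U_increment:
  assumes "a \<le> a'" "0 \<le> a + b" "a' + b \<le> 2 * T"
    and "\<And>s. a < s \<Longrightarrow> s < a' \<Longrightarrow> c \<le> V s b"
  shows "U a b + c / 2 * (a' - a) \<le> U a' b"
proof -
  have "c / 2 * (a' - a) \<le> U a' b - U a b"
    using assms
    by (intro increment_ge[where h' = "\<lambda>y. V y b / 2"] null_continuous dU_da) auto
  then show ?thesis by simp
qed

lemma U_mono_b:
  assumes "b \<le> b'" "0 \<le> a + b" "a + b' \<le> 2 * T"
    and "\<And>s. b < s \<Longrightarrow> s < b' \<Longrightarrow> 0 \<le> W a s"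
  shows "U a b \<le> U a b'"
proof -
  have "0 * (b' - b) \<le> U a b' - U a b"
    using assms
    by (intro increment_ge[where h' = "\<lambda>y. W a y / 2"] null_continuous dU_db) auto
  then show ?thesis by simp
qed

section \<open>Consequences of the sign of the nonlinearity\<close>

lemma initial: "U (- b) b = \<epsilon> * f b" "V a (- a) = - \<epsilon> * deriv f (- a)" "W (- b) b = \<epsilon> * deriv f b"
proof -
  have u0: "u x 0 = \<epsilon> * f x" and ut0: "pd_t T u x 0 = 0" for x
    using sol g_zero by (auto simp: classical_solution_def)
  have ux0: "pd_x u x 0 = \<epsilon> * deriv f x" for x
    unfolding pd_x_def u0 by (rule DERIV_imp_deriv) (rule DERIV_cmult[OF f_deriv])
  show "U (- b) b = \<epsilon> * f b" "V a (- a) = - \<epsilon> * deriv f (- a)" "W (- b) b = \<epsilon> * deriv f b"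
    by (simp_all add: U_def V_def W_def Ut_def Ux_def u0 ut0 ux0)
qed

text \<open>
  Going up along a characteristic from the initial line, \<open>V\<close> and \<open>W\<close> can only increase because
  \<open>F \<ge> 0\<close>. They therefore dominate their values for the free wave.
\<close>

lemma V_ge:
  assumes "0 \<le> a + b" "a + b \<le> 2 * T"
  shows "- \<epsilon> * deriv f (- a) \<le> V a b"
proof -
  have "V a (- a) + 0 / 2 * (b - - a) \<le> V a b"
    using assms F_nonneg by (intro V_increment) auto
  then show ?thesis unfolding initial by simp
qed

lemma W_ge:
  assumes "0 \<le> a + b" "a + b \<le> 2 * T"
  shows "\<epsilon> * deriv f b \<le> W a b"
proof -
  have "W (- b) b \<le> W a b"
    using assms by (intro W_mono) auto
  then show ?thesis unfolding initial .
qed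

lemma V_nonneg:
  assumes "R < a" "0 \<le> a + b" "a + b \<le> 2 * T"
  shows "0 \<le> V a b"
proof -
  have "deriv f (- a) = 0" by (rule deriv_f_outside) (use assms(1) in simp)
  then show ?thesis using V_ge[OF assms(2,3)] by simp
qed

lemma W_nonneg:
  assumes "R < b" "0 \<le> a + b" "a + b \<le> 2 * T"
  shows "0 \<le> W a b"
proof -
  have "deriv f b = 0" by (rule deriv_f_outside) (use assms(1) in simp)
  then show ?thesis using W_ge[OF assms(2,3)] by simp
qed

text \<open>
  Between \<open>a = R / 2\<close> and \<open>a = R\<close> the datum may increase with \<open>x\<close>, and then \<open>V\<close> may be negative. What
  stays monotone in \<open>a\<close> is the excess of \<open>U\<close> over the right-moving free wave \<open>\<epsilon> / 2 * f (- a)\<close>, because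
  \<open>V\<close> dominates its free value. Gains of \<open>U\<close> are for this reason transported through that region as
  gains of the excess.
\<close>

lemma U_excess_increment:
  assumes "a \<le> a'" "0 \<le> a + b" "a' + b \<le> 2 * T"
    and "\<And>s. a < s \<Longrightarrow> s < a' \<Longrightarrow> c \<le> V s b + \<epsilon> * deriv f (- s)"
  shows "U a b - \<epsilon> / 2 * f (- a) + c / 2 * (a' - a) \<le> U a' b - \<epsilon> / 2 * f (- a')"
proof -
  have df: "((\<lambda>a. f (- a)) has_real_derivative - deriv f (- a)) (at a)" for a
    by (rule DERIV_mirror[THEN iffD1, OF f_deriv])
  have "continuous_on {a..a'} (\<lambda>a. f (- a))"
    by (rule DERIV_continuous_on[OF has_field_derivative_at_within[OF df]])
  then have cont: "continuous_on {a..a'} (\<lambda>a. U a b - \<epsilon> / 2 * f (- a))"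
    using assms by (intro continuous_on_diff continuous_on_mult_left null_continuous) auto
  have "c / 2 * (a' - a) \<le> (U a' b - \<epsilon> / 2 * f (- a')) - (U a b - \<epsilon> / 2 * f (- a))"
  proof (rule increment_ge[OF assms(1) cont])
    fix s assume s: "a < s" "s < a'"
    show "((\<lambda>a. U a b - \<epsilon> / 2 * f (- a)) has_real_derivative
        V s b / 2 - \<epsilon> / 2 * - deriv f (- s)) (at s)"
      using s assms by (intro DERIV_diff dU_da DERIV_cmult df) auto
    show "c / 2 \<le> V s b / 2 - \<epsilon> / 2 * - deriv f (- s)"
      using assms(4)[OF s] by simp
  qed
  then show ?thesis by simp
qed

text \<open>
  On the initial line the excess of \<open>U\<close> over the right-moving free wave is the left-moving one,
  \<open>\<epsilon> / 2 * f b\<close>, which is nonnegative.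
\<close>

lemma U_ge:
  assumes "0 \<le> a + b" "a + b \<le> 2 * T"
  shows "\<epsilon> / 2 * f (- a) \<le> U a b"
proof -
  have "0 \<le> V s b + \<epsilon> * deriv f (- s)" if "- b < s" "s < a" for s
    using V_ge[of s b] that assms by auto
  from U_excess_increment[of "- b" a b 0, OF _ _ _ this] assms
  have "\<epsilon> / 2 * f b \<le> U a b - \<epsilon> / 2 * f (- a)"
    by (simp add: initial)
  moreover have "0 \<le> \<epsilon> / 2 * f b" using eps f_nonneg by simp
  ultimately show ?thesis by linarith
qed

lemma U_nonneg:
  assumes "0 \<le> a + b" "a + b \<le> 2 * T"
  shows "0 \<le> U a b"
proof -
  have "0 \<le> \<epsilon> / 2 * f (- a)" using eps f_nonneg by simp
  then show ?thesis using U_ge[OF assms] by linarith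
qed

lemma Ut_ge:
  assumes "R < b" "0 \<le> a + b" "a + b \<le> 2 * T"
  shows "V a b / 2 \<le> Ut a b"
  using W_nonneg[OF assms] by (simp add: V_def W_def)

lemma strip_V_ge:
  assumes "0 < a" "a < R / 2" "0 \<le> a + b" "a + b \<le> 2 * T"
  shows "\<epsilon> * f0 \<le> V a b"
proof -
  have "\<epsilon> * f0 \<le> \<epsilon> * - deriv f (- a)"
    using pulse[of "- a"] assms(1,2) eps by (intro mult_left_mono) auto
  then show ?thesis using V_ge[OF assms(3,4)] by simp
qed

text \<open>
  For \<open>b > R\<close> the left-moving free wave has passed, so \<open>W \<ge> 0\<close> and \<open>u\<^sub>t = (V + W) / 2\<close> inherits half of the
  lower bound for \<open>V\<close>.
\<close>

lemma strip_F_ge: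
  assumes "0 < a" "a < R / 2" "R < b" "a + b \<le> 2 * T"
  shows "A * (\<epsilon> * f0 / 2) powr (p + q) + B * (\<epsilon> * f0 / 2) powr r \<le> F a b"
proof -
  have m: "\<epsilon> * f0 / 2 > 0" using eps f0 by simp
  have "\<epsilon> * f0 / 2 \<le> \<bar>Ut a b\<bar>"
    using strip_V_ge[of a b] Ut_ge[of b a] assms R by auto
  moreover have "\<epsilon> / 2 * f0 \<le> \<epsilon> / 2 * f (- a)"
    using pulse[of "- a"] assms(1,2) eps by (intro mult_left_mono) auto
  then have "\<epsilon> * f0 / 2 \<le> \<bar>U a b\<bar>"
    using U_ge[of a b] assms R by auto
  ultimately have "(\<epsilon> * f0 / 2) powr p * (\<epsilon> * f0 / 2) powr q \<le> \<bar>Ut a b\<bar> powr p * \<bar>U a b\<bar> powr q"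
    and "(\<epsilon> * f0 / 2) powr r \<le> \<bar>U a b\<bar> powr r"
    using m pqr by (intro mult_mono powr_mono2; simp)+
  then show ?thesis
    using AB unfolding F_def powr_add mult.assoc
    by (intro add_mono mult_left_mono) auto
qed

section \<open>Blow-up inside the strip\<close>

text \<open>
  Inside the strip, \<open>V\<close> controls \<open>u\<^sub>t\<close> directly and \<open>u\<close> by integration in \<open>a\<close>, so the mixed term acts
  on \<open>V\<close> like the power \<open>p + q\<close>. If \<open>M\<close> bounds \<open>V\<close> from below for \<open>a > \<alpha>\<^sub>k\<close> and \<open>b \<ge> \<beta>\<^sub>k\<close>, then
  \<open>u \<ge> M (\<alpha>\<^sub>k\<^sub>+\<^sub>1 - \<alpha>\<^sub>k) / 2\<close> for \<open>a > \<alpha>\<^sub>k\<^sub>+\<^sub>1\<close>, and integrating \<open>F\<close> over \<open>b\<close> from \<open>\<beta>\<^sub>k\<close> to \<open>\<beta>\<^sub>k\<^sub>+\<^sub>1\<close>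
  raises the bound. Lengths proportional to \<open>2\<^sup>-\<^sup>k\<close> in both directions cost \<open>2\<^sup>-\<^sup>(\<^sup>q\<^sup>+\<^sup>1\<^sup>)\<^sup>k\<close> and keep the
  domains from shrinking to nothing, so if \<open>T\<close> violated the bound, \<open>V\<close> would be infinite at a point
  common to all domains.
\<close>

lemma damped_growth_bound:
  assumes T_large: "5 * R / 2 \<le> T"
  shows "T * (A * (1/2) powr p * (R/16) powr q / 4) * (\<epsilon> * f0) powr (p + q - 1)
    < 2 powr ((q + 1) / (p + q - 1)) - 1"
proof (rule ccontr)
  define \<Lambda> where "\<Lambda> = T * (A * (1/2) powr p * (R/16) powr q / 4)"
  define s where "s = (q + 1) / (p + q - 1)"
  define m where "m = \<epsilon> * f0"
  define M where "M k = m * 2 powr (s * real k)" for k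
  define \<alpha> where "\<alpha> k = R / 4 * (1 - (1/2) ^ k)" for k :: nat
  define \<beta> where "\<beta> k = 2 * R + T * (1 - (1/2) ^ k)" for k :: nat
  assume "\<not> ?thesis"
  then have large: "2 powr s - 1 \<le> \<Lambda> * m powr (p + q - 1)"
    by (simp add: \<Lambda>_def s_def m_def)
  have m: "m > 0" using eps f0 by (simp add: m_def)
  have M: "M k > 0" for k using m by (simp add: M_def)
  have s: "s * (p + q - 1) = q + 1" "s > 0" using pqr by (auto simp: s_def)
  have \<alpha>: "0 \<le> \<alpha> k" for k using R by (simp add: \<alpha>_def power_le_one)
  have \<beta>: "2 * R \<le> \<beta> k" for k using T by (simp add: \<beta>_def power_le_one)
  have V: "\<forall>a b. \<alpha> k < a \<and> a < R / 2 \<and> \<beta> k \<le> b \<and> a + b \<le> 2 * T \<longrightarrow> M k \<le> V a b" for k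
  proof (induction k)
    case 0
    show ?case
      using strip_V_ge R by (auto simp: M_def \<alpha>_def \<beta>_def m_def)
  next
    case (Suc k)
    show ?case
    proof (intro allI impI, elim conjE)
      fix a b
      assume a: "\<alpha> (Suc k) < a" "a < R / 2" and b: "\<beta> (Suc k) \<le> b" "a + b \<le> 2 * T"
      \<comment> \<open>Lower bound for the mixed term from \<open>u\<^sub>t \<ge> V / 2\<close> and from \<open>u\<close> integrated over \<open>\<alpha>\<^sub>k < a < \<alpha>\<^sub>k\<^sub>+\<^sub>1\<close>.\<close>
      define N where "N = A * (M k / 2) powr p * (M k * (R/16) * (1/2) ^ k) powr q"
      have \<alpha>': "\<alpha> (Suc k) = \<alpha> k + R/8 * (1/2) ^ k" by (simp add: \<alpha>_def field_simps)
      have \<beta>': "\<beta> (Suc k) = \<beta> k + T / 2 * (1/2) ^ k" by (simp add: \<beta>_def field_simps)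
      have "\<alpha> k < a" using a(1) R unfolding \<alpha>' by (smt (verit) zero_less_power divide_pos_pos mult_pos_pos)
      have "\<beta> k \<le> b" using b(1) T unfolding \<beta>' by (smt (verit) zero_less_power divide_pos_pos mult_pos_pos)
      have F: "N \<le> F a y" if y: "\<beta> k < y" "y < b" for y
      proof -
        have ab: "0 \<le> \<alpha> k + y" "a + y \<le> 2 * T" "R < y" "0 \<le> a + y"
          using \<alpha>[of k] \<beta>[of k] y b R \<open>\<alpha> k < a\<close> by auto
        have "M k / 2 \<le> Ut a y"
          using Suc.IH[rule_format, of a y] Ut_ge[OF ab(3,4,2)] \<open>\<alpha> k < a\<close> a(2) y ab by auto
        have "U (\<alpha> k) y + M k / 2 * (a - \<alpha> k) \<le> U a y"
          using Suc.IH \<open>\<alpha> k < a\<close> a(2) y ab by (intro U_increment) auto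
        moreover have "M k / 2 * (R/8 * (1/2) ^ k) \<le> M k / 2 * (a - \<alpha> k)"
          using a(1) M[of k] unfolding \<alpha>' by (intro mult_left_mono) auto
        moreover have "0 \<le> U (\<alpha> k) y"
          using ab \<open>\<alpha> k < a\<close> by (intro U_nonneg) auto
        moreover have "M k * (R/16) * (1/2) ^ k = M k / 2 * (R/8 * (1/2) ^ k)"
          by simp
        ultimately have "M k * (R/16) * (1/2) ^ k \<le> U a y"
          by linarith
        moreover have "0 \<le> M k * (R/16) * (1/2) ^ k" using M[of k] R by simp
        ultimately have "(M k / 2) powr p * (M k * (R/16) * (1/2) ^ k) powr q
            \<le> \<bar>Ut a y\<bar> powr p * \<bar>U a y\<bar> powr q"
          using \<open>M k / 2 \<le> Ut a y\<close> M[of k] pqr by (intro mult_mono powr_mono2) auto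
        then have "N \<le> A * (\<bar>Ut a y\<bar> powr p * \<bar>U a y\<bar> powr q)"
          using AB unfolding N_def by (simp add: mult.assoc)
        then show ?thesis
          using AB unfolding F_def by (simp add: mult.assoc add_increasing2)
      qed
      have "M k \<le> V a (\<beta> k)"
        using Suc.IH \<open>\<alpha> k < a\<close> \<open>\<beta> k \<le> b\<close> a b by auto
      moreover have "V a (\<beta> k) + N / 2 * (b - \<beta> k) \<le> V a b"
        using F \<open>\<beta> k \<le> b\<close> \<open>\<alpha> k < a\<close> \<alpha>[of k] \<beta>[of k] b R by (intro V_increment) auto
      moreover have "N / 2 * (T / 2 * (1/2) ^ k) \<le> N / 2 * (b - \<beta> k)"
        using b(1) AB unfolding \<beta>' N_def by (intro mult_left_mono) auto
      moreover have "N / 2 * (T / 2 * (1/2) ^ k)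
          = \<Lambda> * ((1/2) ^ k) powr (q + 1) * M k powr (p + q)"
        using M[of k] R unfolding N_def \<Lambda>_def
        by (simp add: powr_mult powr_add powr_divide field_simps)
      moreover have "M (Suc k) \<le> M k + \<Lambda> * ((1/2) ^ k) powr (q + 1) * M k powr (p + q)"
        unfolding M_def using m pqr s(1) large by (intro geometric_step) auto
      ultimately show "M (Suc k) \<le> V a b" by linarith
    qed
  qed
  \<comment> \<open>The point \<open>(R / 4, 2 R + T)\<close> is the limit of the corners \<open>(\<alpha>\<^sub>k, \<beta>\<^sub>k)\<close> and lies in every domain of the iteration.\<close>
  obtain k where "V (R / 4) (2 * R + T) < M k"
    using geometric_unbounded[OF m s(2)] unfolding M_def by blast
  moreover have "M k \<le> V (R / 4) (2 * R + T)"
    using V[rule_format, of k "R / 4" "2 * R + T"] R T T_large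
    by (auto simp: \<alpha>_def \<beta>_def algebra_simps)
  ultimately show False by simp
qed

section \<open>Blow-up in the interior of the light cone\<close>

text \<open>
  While crossing the strip, \<open>V\<close> picks up \<open>N / 2\<close> per unit of \<open>b\<close>. Integrating over the width of the
  strip makes the excess of \<open>U\<close> grow linearly in \<open>b\<close>, and it keeps this gain for all larger \<open>a\<close>.
\<close>

lemma linear_growth:
  assumes N: "N \<le> A * (\<epsilon> * f0 / 2) powr (p + q) + B * (\<epsilon> * f0 / 2) powr r"
    and ab: "R / 2 \<le> a" "2 * R \<le> b" "a + b \<le> 2 * T"
  shows "R / 8 * (b - 2 * R) * N \<le> U a b"
proof -
  have V: "N / 2 * (b - 2 * R) \<le> V s b + \<epsilon> * deriv f (- s)" if s: "0 < s" "s < R / 2" for s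
  proof -
    have "N \<le> F s y" if "2 * R < y" "y < b" for y
      using strip_F_ge[of s y] N s ab that R by auto
    then have "V s (2 * R) + N / 2 * (b - 2 * R) \<le> V s b"
      using s ab R by (intro V_increment) auto
    moreover have "- \<epsilon> * deriv f (- s) \<le> V s (2 * R)"
      using s ab R by (intro V_ge) auto
    ultimately show ?thesis by simp
  qed
  \<comment> \<open>Two stages: the strip itself, where the gain is made, and the region beyond it, where none is lost.\<close>
  have "U 0 b - \<epsilon> / 2 * f (- 0) + N / 2 * (b - 2 * R) / 2 * (R / 2 - 0)
      \<le> U (R / 2) b - \<epsilon> / 2 * f (- (R / 2))"
    using V ab R by (intro U_excess_increment) auto
  moreover have "\<epsilon> / 2 * f (- 0) \<le> U 0 b"
    using ab R by (intro U_ge) auto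
  moreover have "U (R / 2) b - \<epsilon> / 2 * f (- (R / 2)) + 0 / 2 * (a - R / 2) \<le> U a b - \<epsilon> / 2 * f (- a)"
  proof (rule U_excess_increment)
    show "0 \<le> V s b + \<epsilon> * deriv f (- s)" if "R / 2 < s" "s < a" for s
      using V_ge[of s b] that ab R by auto
  qed (use ab R in auto)
  moreover have "0 \<le> \<epsilon> / 2 * f (- a)" using eps f_nonneg by simp
  moreover have "N / 2 * (b - 2 * R) / 2 * (R / 2 - 0) = R / 8 * (b - 2 * R) * N" by simp
  ultimately show ?thesis by linarith
qed

text \<open>
  On the square \<open>T / 2 \<le> a, b \<le> T\<close> the solution increases in both variables and is at least of order
  \<open>T N\<close> by the linear growth. If \<open>U \<ge> M\<close> beyond the diagonal point \<open>\<alpha>\<^sub>k\<close>, then the source \<open>B u\<^sup>r\<close>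
  raises \<open>U\<close> at \<open>\<alpha>\<^sub>k\<^sub>+\<^sub>1\<close> by \<open>B M\<^sup>r / 4\<close> times the area of the square between the two points. The area is
  proportional to \<open>T\<^sup>2 4\<^sup>-\<^sup>k\<close>, whence the loss exponent \<open>2\<close>; all diagonal points stay below \<open>(T, T)\<close>,
  where \<open>U\<close> would be infinite.
\<close>

lemma source_growth_bound:
  assumes N: "0 < N" "N \<le> A * (\<epsilon> * f0 / 2) powr (p + q) + B * (\<epsilon> * f0 / 2) powr r"
    and T_large: "8 * R \<le> T"
  shows "B * T\<^sup>2 / 64 * (R * T * N / 32) powr (r - 1) < 2 powr (2 / (r - 1)) - 1"
proof (rule ccontr)
  define \<Lambda> where "\<Lambda> = B * T\<^sup>2 / 64"
  define s where "s = 2 / (r - 1)"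
  define K where "K = R * T * N / 32"
  define M where "M k = K * 2 powr (s * real k)" for k
  define \<alpha> where "\<alpha> k = T - T / 2 * (1/2) ^ k" for k :: nat
  assume "\<not> ?thesis"
  then have large: "2 powr s - 1 \<le> \<Lambda> * K powr (r - 1)"
    by (simp add: \<Lambda>_def s_def K_def)
  have K: "K > 0" using N R T by (simp add: K_def)
  have M: "M k > 0" for k using K by (simp add: M_def)
  have s: "s * (r - 1) = 2" "s > 0" using pqr by (simp_all add: s_def field_simps)
  have \<alpha>: "T / 2 \<le> \<alpha> k" "\<alpha> k \<le> T" for k
  proof -
    have "T / 2 * (1/2) ^ k \<le> T / 2 * 1"
      using T by (intro mult_left_mono power_le_one) auto
    then show "T / 2 \<le> \<alpha> k" "\<alpha> k \<le> T" using T by (auto simp: \<alpha>_def)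
  qed
  have mono: "U a b \<le> U a' b'"
    if "T / 2 \<le> a" "T / 2 \<le> b" "a \<le> a'" "b \<le> b'" "a' \<le> T" "b' \<le> T" for a b a' b'
  proof -
    have "U a b \<le> U a b'"
      using that T_large R T by (intro U_mono_b W_nonneg) auto
    also have "U a b' + 0 / 2 * (a' - a) \<le> U a' b'"
      using that T_large R T by (intro U_increment V_nonneg) auto
    finally show ?thesis by simp
  qed
  have U: "M k \<le> U (\<alpha> k) (\<alpha> k)" for k
  proof (induction k)
    case 0
    \<comment> \<open>Here \<open>T \<ge> 8 R\<close> makes \<open>T / 2 - 2 R\<close> comparable to \<open>T\<close>.\<close>
    have "R / 8 * (T / 4) * N \<le> R / 8 * (T / 2 - 2 * R) * N"
      using T_large R N by (intro mult_mono) auto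
    also have "\<dots> \<le> U (T / 2) (T / 2)"
      using N T_large R T by (intro linear_growth) auto
    finally show ?case by (simp add: M_def K_def \<alpha>_def)
  next
    case (Suc k)
    define h where "h = T / 4 * (1/2) ^ k"
    have \<alpha>': "\<alpha> (Suc k) = \<alpha> k + h" by (simp add: \<alpha>_def h_def field_simps)
    have h: "h > 0" using T by (simp add: h_def)
    have ab: "R < \<alpha> k" "\<alpha> k + h \<le> T" using \<alpha>[of k] \<alpha>[of "Suc k"] T_large R \<alpha>' by auto
    have V: "B * M k powr r / 2 * h \<le> V a (\<alpha> k + h)" if a: "\<alpha> k < a" "a < \<alpha> k + h" for a
    proof -
      have "B * M k powr r \<le> F a y" if y: "\<alpha> k < y" "y < \<alpha> k + h" for y
      proof -
        have "M k \<le> U a y"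
          using Suc mono[of "\<alpha> k" "\<alpha> k" a y] \<alpha>[of k] a y ab by auto
        then have "M k powr r \<le> \<bar>U a y\<bar> powr r"
          using M[of k] pqr by (intro powr_mono2) auto
        then have "B * M k powr r \<le> B * \<bar>U a y\<bar> powr r" using AB by simp
        then show ?thesis using AB unfolding F_def by (simp add: add_increasing)
      qed
      then have "V a (\<alpha> k) + B * M k powr r / 2 * (\<alpha> k + h - \<alpha> k) \<le> V a (\<alpha> k + h)"
        using a ab h R by (intro V_increment) auto
      moreover have "0 \<le> V a (\<alpha> k)"
        using a ab h R by (intro V_nonneg) auto
      ultimately show ?thesis by simp
    qed
    have "U (\<alpha> k) (\<alpha> k + h) + B * M k powr r / 2 * h / 2 * (\<alpha> k + h - \<alpha> k) \<le> U (\<alpha> k + h) (\<alpha> k + h)"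
      using V ab h R by (intro U_increment) auto
    moreover have "M k \<le> U (\<alpha> k) (\<alpha> k + h)"
      using Suc mono[of "\<alpha> k" "\<alpha> k" "\<alpha> k" "\<alpha> k + h"] \<alpha>[of k] ab h by auto
    moreover have "B * M k powr r / 2 * h / 2 * (\<alpha> k + h - \<alpha> k)
        = \<Lambda> * ((1/2) ^ k) powr 2 * M k powr r"
      by (simp add: \<Lambda>_def h_def power2_eq_square)
    moreover have "M (Suc k) \<le> M k + \<Lambda> * ((1/2) ^ k) powr 2 * M k powr r"
      unfolding M_def using K pqr s(1) large by (intro geometric_step) auto
    ultimately show ?case unfolding \<alpha>' by linarith
  qed
  obtain k where "U T T < M k"
    using geometric_unbounded[OF K s(2)] unfolding M_def by blast
  moreover have "U (\<alpha> k) (\<alpha> k) \<le> U T T"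
    using \<alpha>[of k] by (intro mono) auto
  ultimately show False using U[of k] by simp
qed

section \<open>Lifespan in terms of the amplitude\<close>

text \<open>
  Since \<open>\<epsilon> \<le> 1\<close> and the exponent is negative, \<open>T \<ge> C\<close>. A large \<open>C\<close> thus also secures the lower bound on
  \<open>T\<close> that the growth argument needs.
\<close>

lemma damped_lifespan:
  assumes eps1: "\<epsilon> \<le> 1" and C: "5 * R / 2 \<le> C"
    and T_ge: "C * \<epsilon> powr (- (p + q - 1)) \<le> T"
    and C_large: "2 powr ((q + 1) / (p + q - 1)) - 1
      \<le> A * (1/2) powr p * (R/16) powr q / 4 * f0 powr (p + q - 1) * C powr 1"
  shows False
proof -
  define k where "k = A * (1/2) powr p * (R/16) powr q / 4"
  have "C > 0" using C R by linarith
  have "1 \<le> \<epsilon> powr (- (p + q - 1))"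
    using powr_mono'[of "- (p + q - 1)" 0 \<epsilon>] eps eps1 pqr by simp
  then have "C \<le> C * \<epsilon> powr (- (p + q - 1))" using \<open>C > 0\<close> by simp
  then have "5 * R / 2 \<le> T" using C T_ge by linarith
  note bound = damped_growth_bound[OF this, folded k_def]
  have "k * f0 powr (p + q - 1) * C
      = C * \<epsilon> powr (- (p + q - 1)) * k * (\<epsilon> * f0) powr (p + q - 1)"
    using eps f0 by (simp add: powr_mult powr_add[symmetric])
  also have "\<dots> \<le> T * k * (\<epsilon> * f0) powr (p + q - 1)"
    using T_ge AB by (intro mult_right_mono) (auto simp: k_def)
  finally show False
    using bound C_large \<open>C > 0\<close> by (simp add: k_def)
qed

text \<open>
  The growth bound limits \<open>T\<^sup>2 (T N)\<^sup>r\<^sup>-\<^sup>1 = T\<^sup>r\<^sup>+\<^sup>1 N\<^sup>r\<^sup>-\<^sup>1\<close>. With \<open>N\<close> proportional to \<open>\<epsilon>\<^sup>P\<close> this is a bound on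
  \<open>T \<epsilon>\<^sup>\<gamma>\<close> for \<open>\<gamma> = P (r - 1) / (r + 1)\<close>. The mixed term allows \<open>P = p + q\<close> and the source \<open>P = r\<close>.
\<close>

lemma source_lifespan:
  assumes eps1: "\<epsilon> \<le> 1" and C: "8 * R \<le> C" and P: "P > 0" and n: "n > 0"
    and N: "n * \<epsilon> powr P \<le> A * (\<epsilon> * f0 / 2) powr (p + q) + B * (\<epsilon> * f0 / 2) powr r"
    and T_ge: "C * \<epsilon> powr (- (P * (r - 1) / (r + 1))) \<le> T"
    and C_large: "2 powr (2 / (r - 1)) - 1 \<le> B / 64 * (R * n / 32) powr (r - 1) * C powr (r + 1)"
  shows False
proof -
  define \<gamma> where "\<gamma> = P * (r - 1) / (r + 1)"
  have \<gamma>: "\<gamma> > 0" "\<gamma> * (r + 1) = P * (r - 1)" using P pqr by (auto simp: \<gamma>_def)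
  have "C > 0" using C R by linarith
  have "1 \<le> \<epsilon> powr (- \<gamma>)"
    using powr_mono'[of "- \<gamma>" 0 \<epsilon>] eps eps1 \<gamma> by simp
  then have "C \<le> C * \<epsilon> powr (- \<gamma>)" using \<open>C > 0\<close> by simp
  then have "8 * R \<le> T" using C T_ge by (simp add: \<gamma>_def)
  note bound = source_growth_bound[OF _ N this]
  have "\<epsilon> powr (- \<gamma> * (r + 1)) * \<epsilon> powr (P * (r - 1)) = 1"
    using eps unfolding \<gamma>(2)[symmetric] powr_add[symmetric] by simp
  then have "C powr (r + 1) = (C * \<epsilon> powr (- \<gamma>)) powr (r + 1) * \<epsilon> powr (P * (r - 1))"
    using \<open>C > 0\<close> eps by (simp add: powr_mult powr_powr)
  also have "\<dots> \<le> T powr (r + 1) * \<epsilon> powr (P * (r - 1))"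
    using T_ge \<open>C > 0\<close> eps pqr by (intro mult_right_mono powr_mono2) (auto simp: \<gamma>_def)
  finally have "B / 64 * (R * n / 32) powr (r - 1) * C powr (r + 1)
      \<le> B / 64 * (R * n / 32) powr (r - 1) * (T powr (r + 1) * \<epsilon> powr (P * (r - 1)))"
    using AB by (intro mult_left_mono) auto
  also have "T powr (r + 1) = T\<^sup>2 * T powr (r - 1)"
    using T powr_add[of T 2 "r - 1"] by (simp add: add.commute)
  also have "B / 64 * (R * n / 32) powr (r - 1) * (T\<^sup>2 * T powr (r - 1) * \<epsilon> powr (P * (r - 1)))
      = B * T\<^sup>2 / 64 * (R * T * (n * \<epsilon> powr P) / 32) powr (r - 1)"
    using R T n eps by (simp add: powr_mult powr_powr powr_divide)
  finally show False
    using bound C_large n eps by simp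
qed

end

lemma powr_threshold:
  fixes c \<alpha> X :: real
  assumes "c > 0" "\<alpha> > 0"
  shows "\<exists>C0. \<forall>C\<ge>C0. X \<le> c * C powr \<alpha>"
proof (intro exI allI impI)
  fix C assume C: "(\<bar>X\<bar> / c) powr (1 / \<alpha>) \<le> C"
  have "\<bar>X\<bar> / c = ((\<bar>X\<bar> / c) powr (1 / \<alpha>)) powr \<alpha>"
    using assms by (simp add: powr_powr)
  also have "\<dots> \<le> C powr \<alpha>"
    using C assms by (intro powr_mono2) auto
  finally show "X \<le> c * C powr \<alpha>"
    using assms by (simp add: field_simps)
qed

theorem theorem2p4:
  fixes p q r A B R f0 :: real and f g :: "real \<Rightarrow> real"
  assumes "p > 1" "q > 1" "r > 1" "A > 0" "B > 0" "R \<ge> 1"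
    and "f \<in> C0k 2" "g \<in> C0k 1"
    and "supp f \<subseteq> {x. \<bar>x\<bar> \<le> R}" "supp g \<subseteq> {x. \<bar>x\<bar> \<le> R}"
    and "\<forall>x. f x \<ge> 0" "\<exists>x. f x \<noteq> 0" "\<forall>x. g x = 0"
    and "f0 > 0"
    and "\<forall>x\<in>{-R/2<..<0}. f x \<ge> f0 \<and> - deriv f x \<ge> f0"
  shows "\<exists>\<epsilon>4>0. \<exists>C>0. \<forall>\<epsilon> T :: real. 0 < \<epsilon> \<and> \<epsilon> \<le> \<epsilon>4 \<and>
           (p + q \<le> (r + 1) / 2 \<longrightarrow> T \<ge> C * \<epsilon> powr (- (p + q - 1))) \<and>
           ((r + 1) / 2 \<le> p + q \<and> p + q \<le> r \<longrightarrow>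
              T \<ge> C * \<epsilon> powr (- ((p + q) * (r - 1) / (r + 1)))) \<and>
           (p + q \<ge> r \<longrightarrow> T \<ge> C * \<epsilon> powr (- (r * (r - 1) / (r + 1)))) \<longrightarrow>
           \<not> (\<exists>u. classical_solution p q r A B f g \<epsilon> T u)"
proof -
  define X where "X = (2 :: real) powr (2 / (r - 1)) - 1"
  have pos: "A * (1/2) powr p * (R/16) powr q / 4 * f0 powr (p + q - 1) > 0"
    "B / 64 * (R * (A * (f0 / 2) powr (p + q)) / 32) powr (r - 1) > 0"
    "B / 64 * (R * (B * (f0 / 2) powr r) / 32) powr (r - 1) > 0"
    using assms(4-6,14) by (auto intro!: mult_pos_pos divide_pos_pos)
  obtain C1 where C1: "\<And>C. C1 \<le> C \<Longrightarrow> 2 powr ((q + 1) / (p + q - 1)) - 1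
      \<le> A * (1/2) powr p * (R/16) powr q / 4 * f0 powr (p + q - 1) * C powr 1"
    using powr_threshold[OF pos(1), of 1 "2 powr ((q + 1) / (p + q - 1)) - 1"] by auto
  obtain C2 where C2: "\<And>C. C2 \<le> C \<Longrightarrow>
      X \<le> B / 64 * (R * (A * (f0 / 2) powr (p + q)) / 32) powr (r - 1) * C powr (r + 1)"
    using powr_threshold[OF pos(2), of "r + 1" X] assms(3) by auto
  obtain C3 where C3: "\<And>C. C3 \<le> C \<Longrightarrow>
      X \<le> B / 64 * (R * (B * (f0 / 2) powr r) / 32) powr (r - 1) * C powr (r + 1)"
    using powr_threshold[OF pos(3), of "r + 1" X] assms(3) by auto
  define C where "C = Max {8 * R, C1, C2, C3}"
  have C: "8 * R \<le> C" "C1 \<le> C" "C2 \<le> C" "C3 \<le> C" by (simp_all add: C_def)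
  have "C > 0" using C(1) assms(6) by linarith
  show ?thesis
  proof (rule exI[of _ 1], rule conjI, simp, rule exI[of _ C], intro conjI allI impI notI)
    fix \<epsilon> T :: real
    assume hyp: "0 < \<epsilon> \<and> \<epsilon> \<le> 1 \<and>
       (p + q \<le> (r + 1) / 2 \<longrightarrow> T \<ge> C * \<epsilon> powr (- (p + q - 1))) \<and>
       ((r + 1) / 2 \<le> p + q \<and> p + q \<le> r \<longrightarrow>
          T \<ge> C * \<epsilon> powr (- ((p + q) * (r - 1) / (r + 1)))) \<and>
       (p + q \<ge> r \<longrightarrow> T \<ge> C * \<epsilon> powr (- (r * (r - 1) / (r + 1))))"
      and "\<exists>u. classical_solution p q r A B f g \<epsilon> T u"
    then obtain u where sol: "classical_solution p q r A B f g \<epsilon> T u" by blast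
    have eps01: "0 < \<epsilon>" "\<epsilon> \<le> 1" using hyp by auto
    consider "p + q \<le> (r + 1) / 2" | "(r + 1) / 2 \<le> p + q" "p + q \<le> r" | "r \<le> p + q"
      by linarith
    \<comment> \<open>Some case of the hypothesis applies, and each of them bounds \<open>T\<close> below by a positive number.\<close>
    then obtain \<gamma> where "C * \<epsilon> powr \<gamma> \<le> T" using hyp by cases blast+
    moreover have "0 < C * \<epsilon> powr \<gamma>" using \<open>C > 0\<close> eps01 by simp
    ultimately have "T > 0" by linarith
    interpret decreasing_pulse p q r A B R f0 \<epsilon> T f g u
      using assms sol eps01 \<open>T > 0\<close>
      by unfold_locales (auto simp: C0k_def numeral_2_eq_2)
    have scale: "n * (f0 / 2) powr P * \<epsilon> powr P = n * (\<epsilon> * f0 / 2) powr P" for n P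
      using eps01 assms(14) by (simp add: powr_mult powr_divide)
    consider "p + q \<le> (r + 1) / 2" | "(r + 1) / 2 \<le> p + q" "p + q \<le> r" | "r \<le> p + q"
      by linarith
    then show False
    proof cases
      case 1
      then show False
        using hyp C(1) assms(6) by (intro damped_lifespan[OF eps01(2) _ _ C1[OF C(2)]]) auto
    next
      case 2
      show False
      proof (rule source_lifespan[OF eps01(2) C(1) _ _ _ _ C2[OF C(3), unfolded X_def]])
        show "A * (f0 / 2) powr (p + q) * \<epsilon> powr (p + q)
            \<le> A * (\<epsilon> * f0 / 2) powr (p + q) + B * (\<epsilon> * f0 / 2) powr r"
          unfolding scale using assms(5) by simp
      qed (use 2 hyp assms in auto)
    next
      case 3
      show False
      proof (rule source_lifespan[OF eps01(2) C(1) _ _ _ _ C3[OF C(4), unfolded X_def]])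
        show "B * (f0 / 2) powr r * \<epsilon> powr r
            \<le> A * (\<epsilon> * f0 / 2) powr (p + q) + B * (\<epsilon> * f0 / 2) powr r"
          unfolding scale using assms(4) by simp
      qed (use 3 hyp assms in auto)
    qed
  qed (use \<open>C > 0\<close> in auto)
qed

end
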